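(* Let $n\ge2$, $\alpha_1,\dots,\alpha_n>0$, $k>1$, $g(u):=\frac{1+u}{k+u}$, and consider the system on $\mathbb{R}^n_+=[0,\infty)^n$ $$\dot x_1=g(x_n)-\alpha_1x_1,\qquad \dot x_i=x_{i-1}-\alpha_ix_i\quad (i=2,\dots,n).$$ Let $\alpha:=\prod_{i=1}^n\alpha_i$. (1) If $k-1<\alpha k^2$, then the system is contractive on $\mathbb{R}^n_+$ (with respect to some norm). (2) If $k-1=\alpha k^2$, then the system is not contractive on $\mathbb{R}^n_+$ with respect to any norm, yet it is a contraction after a small overshoot (SO) on $\mathbb{R}^n_+$ (with respect to some norm).
   Context: For $t_0\ge0$ and $x_0\in\mathbb{R}^n_+$, $x(t,t_0,x_0)$ denotes the solution at time $t\ge t_0$ with $x(t_0)=x_0$; the set $\mathbb{R}^n_+$ is forward invariant for the system. Contractive: a system is contractive on $\Omega$ with respect to a norm $|\cdot|$ on $\mathbb{R}^n$ if there exists $c>0$ such that $|x(t_2,t_1,a)-x(t_2,t_1,b)|\le\exp(-(t_2-t_1)c)|a-b|$ for all $t_2\ge t_1\ge0$ and all $a,b\in\Omega$. Contraction after a small overshoot (SO): a system is SO on $\Omega$ with respect to a norm $|\cdot|$ on $\mathbb{R}^n$ if for each $\varepsilon>0$ there exists $\ell=\ell(\varepsilon)>0$ such that $|x(t_2,t_1,a)-x(t_2,t_1,b)|\le(1+\varepsilon)\exp(-(t_2-t_1)\ell)|a-b|$ for all $t_2\ge t_1\ge0$ and all $a,b\in\Omega$. *)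

theory Defs
  imports "HOL-Analysis.Analysis"
begin

definition is_norm :: "('a::real_vector \<Rightarrow> real) \<Rightarrow> bool" where
  "is_norm N \<longleftrightarrow>
     (\<forall>x. 0 \<le> N x) \<and>
     (\<forall>x. N x = 0 \<longleftrightarrow> x = 0) \<and>
     (\<forall>r x. N (r *\<^sub>R x) = \<bar>r\<bar> * N x) \<and>
     (\<forall>x y. N (x + y) \<le> N x + N y)"

definition is_solution ::
    "('a::real_normed_vector \<Rightarrow> 'a) \<Rightarrow> 'a set \<Rightarrow> real \<Rightarrow> 'a \<Rightarrow> (real \<Rightarrow> 'a) \<Rightarrow> bool" where
  "is_solution f X t0 x0 \<phi> \<longleftrightarrow>
     \<phi> t0 = x0 \<and>
     (\<forall>t\<ge>t0. \<phi> t \<in> X \<and> (\<phi> has_vector_derivative f (\<phi> t)) (at t within {t0..}))"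

(* The argument order t, t0, x0 is that of the usual notation x(t, t0, x0). The description
   ranges over the value at time t, not over the trajectory, because is_solution leaves
   trajectories unconstrained before t0. It is meaningful only for t \<ge> t0, when the initial
   value problem on the state space X is well posed. *)
definition solution_at ::
    "('a::real_normed_vector \<Rightarrow> 'a) \<Rightarrow> 'a set \<Rightarrow> real \<Rightarrow> real \<Rightarrow> 'a \<Rightarrow> 'a" where
  "solution_at f X t t0 x0 = (THE y. \<exists>\<phi>. is_solution f X t0 x0 \<phi> \<and> y = \<phi> t)"

(* In the next two definitions x is the solution map x(t, t0, x0), and N is a norm. *)
definition contractive_on ::
    "(real \<Rightarrow> real \<Rightarrow> 'a::real_vector \<Rightarrow> 'a) \<Rightarrow> 'a set \<Rightarrow> ('a \<Rightarrow> real) \<Rightarrow> bool" where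
  "contractive_on x \<Omega> N \<longleftrightarrow>
     (\<exists>c>0. \<forall>t1\<ge>0. \<forall>t2\<ge>t1. \<forall>a\<in>\<Omega>. \<forall>b\<in>\<Omega>.
        N (x t2 t1 a - x t2 t1 b) \<le> exp (- (t2 - t1) * c) * N (a - b))"

definition SO_on ::
    "(real \<Rightarrow> real \<Rightarrow> 'a::real_vector \<Rightarrow> 'a) \<Rightarrow> 'a set \<Rightarrow> ('a \<Rightarrow> real) \<Rightarrow> bool" where
  "SO_on x \<Omega> N \<longleftrightarrow>
     (\<forall>\<epsilon>>0. \<exists>l>0. \<forall>t1\<ge>0. \<forall>t2\<ge>t1. \<forall>a\<in>\<Omega>. \<forall>b\<in>\<Omega>.
        N (x t2 t1 a - x t2 t1 b) \<le> (1 + \<epsilon>) * exp (- (t2 - t1) * l) * N (a - b))"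

definition nonneg_orthant :: "(real ^ 'n) set" where
  "nonneg_orthant = {x. \<forall>j. 0 \<le> x $ j}"

definition g :: "real \<Rightarrow> real \<Rightarrow> real" where
  "g k u = (1 + u) / (k + u)"

(* The map e enumerates the index type as e 1, ..., e n with n = CARD('n), so that the i-th
   coordinate of x is x $ e i. See vector_field_nth for the componentwise form. *)
definition vector_field ::
    "(nat \<Rightarrow> 'n) \<Rightarrow> (nat \<Rightarrow> real) \<Rightarrow> real \<Rightarrow> real ^ 'n \<Rightarrow> real ^ 'n::finite" where
  "vector_field e \<alpha> k x = (\<chi> j.
     let i = inv_into {1..CARD('n)} e j
     in (if i = 1 then g k (x $ e CARD('n)) else x $ e (i - 1)) - \<alpha> i * x $ e i)"

lemma vector_field_nth:
  fixes e :: "nat \<Rightarrow> 'n::finite"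
  assumes "bij_betw e {1..CARD('n)} UNIV"
  shows "vector_field e \<alpha> k x $ e 1 = g k (x $ e CARD('n)) - \<alpha> 1 * x $ e 1"
    and "i \<in> {2..CARD('n)} \<Longrightarrow> vector_field e \<alpha> k x $ e i = x $ e (i - 1) - \<alpha> i * x $ e i"
proof -
  have inv: "inv_into {1..CARD('n)} e (e i) = i" if "i \<in> {1..CARD('n)}" for i
    using assms that by (meson bij_betw_def inv_into_f_f)
  have "0 < CARD('n)" by simp
  then have "1 \<in> {1..CARD('n)}" by (simp add: Suc_le_eq)
  from inv[OF this]
  show "vector_field e \<alpha> k x $ e 1 = g k (x $ e CARD('n)) - \<alpha> 1 * x $ e 1"
    by (simp add: vector_field_def)
  show "vector_field e \<alpha> k x $ e i = x $ e (i - 1) - \<alpha> i * x $ e i" if "i \<in> {2..CARD('n)}"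
    using that inv[of i] by (simp add: vector_field_def)
qed

end

theory Submission
  imports Defs
begin

text \<open>
  The system is cooperative: every off-diagonal entry of its Jacobian is nonnegative on the
  orthant, so the flow preserves the componentwise order. This makes weighted \<open>l\<^sup>1\<close> norms the natural
  ones to use. For ordered solutions \<open>\<phi> \<le> \<psi>\<close> the norm of \<open>\<psi> - \<phi>\<close> is a linear function of it, hence
  differentiable, and two arbitrary points are compared by passing through their componentwise
  maximum, along which an \<open>l\<^sup>1\<close> norm is additive (\<open>wnorm_bound_from_ordered\<close>).

  With the weights \<open>w\<^sub>i = (\<alpha>\<^sub>1 - c) \<dots> (\<alpha>\<^sub>i\<^sub>-\<^sub>1 - c)\<close> the sum telescopes around the cycle: for \<open>z = \<psi> - \<phi>\<close>
  and \<open>V = \<Sum> w\<^sub>i z\<^sub>i\<close> one gets \<open>V' = - c V + (g(\<psi>\<^sub>n) - g(\<phi>\<^sub>n)) - (\<Prod> (\<alpha>\<^sub>i - c)) z\<^sub>n\<close>. Hence \<open>V\<close> decays at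
  rate \<open>c\<close> as soon as the slope of \<open>g\<close> along the two solutions is at most \<open>\<Prod> (\<alpha>\<^sub>i - c)\<close>
  (\<open>ordered_solutions_contract\<close>). The slope of \<open>g\<close> is largest at \<open>0\<close>, where it equals \<open>(k - 1) / k\<^sup>2\<close>.

  If \<open>(k - 1) / k\<^sup>2 < \<Prod> \<alpha>\<^sub>i\<close>, a small \<open>c > 0\<close> works everywhere, and the system is contractive.

  If \<open>(k - 1) / k\<^sup>2 = \<Prod> \<alpha>\<^sub>i\<close>, then \<open>c = 0\<close> still shows that the norm does not increase. Moreover the
  production term \<open>g \<ge> 1 / k\<close> pushes every solution, within a time that does not depend on the
  initial value, into a region \<open>x\<^sub>n \<ge> \<eta> > 0\<close> (\<open>coordinate_lower_bound\<close>), where the slope of \<open>g\<close> is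
  smaller than \<open>\<Prod> \<alpha>\<^sub>i\<close> and some \<open>c > 0\<close> is available. As \<open>c\<close> tends to \<open>0\<close>, both the distortion between
  the norms for \<open>c\<close> and for \<open>0\<close> and the factor \<open>exp (n c)\<close> lost during the waiting time tend to \<open>1\<close>,
  which is contraction after a small overshoot for the norm with \<open>c = 0\<close>.

  Contraction itself fails in the critical case because the Jacobian at \<open>0\<close> has a positive kernel
  vector \<open>v\<close>. A contraction at rate \<open>c\<close> in a norm \<open>N\<close> would give \<open>c N(a - b) \<le> N(f(a) - f(b))\<close>
  (\<open>contraction_rate_le_field\<close>); but for \<open>a = \<delta> v\<close>, \<open>b = 0\<close> the left side is of order \<open>\<delta>\<close> and the
  right side of order \<open>\<delta>\<^sup>2\<close>.

  Existence of solutions in the orthant and monotonicity of the flow both come from one Picard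
  iteration that stays inside a closed convex cone (\<open>solution_in_dual_cone_exists\<close>), applied to two
  copies of the system on the cone of pairs \<open>0 \<le> a \<le> b\<close>.
\<close>


section \<open>Differential inequalities and uniqueness of solutions\<close>

text \<open>The weighted function \<open>exp (- c (t - s)) * V t\<close> is nonincreasing. Derivatives are taken within
  \<open>{s..}\<close> because solutions are one-sided at their initial time.\<close>

lemma exp_growth_bound:
  fixes V :: "real \<Rightarrow> real"
  assumes deriv: "\<And>t. s \<le> t \<Longrightarrow> (V has_real_derivative V' t) (at t within {s..})"
    and le: "\<And>t. s \<le> t \<Longrightarrow> V' t \<le> c * V t"
    and "s \<le> t"
  shows "V t \<le> exp (c * (t - s)) * V s"
proof -
  define W where "W t = exp (- c * (t - s)) * V t" for t
  have dW: "(W has_real_derivative exp (- c * (t - s)) * (V' t - c * V t)) (at t within {s..})"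
    if "s \<le> t" for t
    unfolding W_def by (auto intro!: derivative_eq_intros deriv that simp: algebra_simps)
  have "W t \<le> W s"
  proof (rule DERIV_nonpos_imp_decreasing_open[OF \<open>s \<le> t\<close>])
    fix r assume r: "s < r" "r < t"
    have "at r within {s..} = at r"
      using r by (intro at_within_nhd[of r "{s<..}"]) auto
    then show "\<exists>y. (W has_real_derivative y) (at r) \<and> y \<le> 0"
      using dW[of r] le[of r] r by (intro exI conjI) (auto intro!: mult_nonneg_nonpos)
  next
    have "continuous_on {s..} W"
      using dW by (intro DERIV_continuous_on) auto
    then show "continuous_on {s..t} W"
      by (rule continuous_on_subset) auto
  qed
  then have "exp (c * (t - s)) * W t \<le> exp (c * (t - s)) * W s"
    by simp
  then show ?thesis
    by (simp add: W_def mult.assoc[symmetric] exp_add[symmetric])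
qed

text \<open>The squared distance of the two solutions grows at most at rate \<open>2 L\<close> and is zero at \<open>t0\<close>.\<close>

lemma is_solution_unique:
  fixes f :: "'a::real_inner \<Rightarrow> 'a"
  assumes lip: "L-lipschitz_on X f"
    and sol: "is_solution f X t0 x0 \<phi>" "is_solution f X t0 x0 \<psi>"
    and "t0 \<le> t"
  shows "\<phi> t = \<psi> t"
proof -
  define V where "V s = (\<phi> s - \<psi> s) \<bullet> (\<phi> s - \<psi> s)" for s
  define V' where "V' s = 2 * ((\<phi> s - \<psi> s) \<bullet> (f (\<phi> s) - f (\<psi> s)))" for s
  have "V t \<le> exp (2 * L * (t - t0)) * V t0"
  proof (rule exp_growth_bound[OF _ _ \<open>t0 \<le> t\<close>])
    fix s assume "t0 \<le> s"
    then have der: "(\<phi> has_vector_derivative f (\<phi> s)) (at s within {t0..})"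
      "(\<psi> has_vector_derivative f (\<psi> s)) (at s within {t0..})"
      and mem: "\<phi> s \<in> X" "\<psi> s \<in> X"
      using sol by (auto simp: is_solution_def)
    show "(V has_real_derivative V' s) (at s within {t0..})"
      using der unfolding V_def V'_def has_real_derivative_iff_has_vector_derivative
        has_vector_derivative_def
      by (auto intro!: derivative_eq_intros simp: fun_eq_iff inner_commute algebra_simps)
    have "(\<phi> s - \<psi> s) \<bullet> (f (\<phi> s) - f (\<psi> s)) \<le> norm (\<phi> s - \<psi> s) * norm (f (\<phi> s) - f (\<psi> s))"
      by (rule norm_cauchy_schwarz)
    also have "\<dots> \<le> norm (\<phi> s - \<psi> s) * (L * norm (\<phi> s - \<psi> s))"
      by (intro mult_left_mono lipschitz_on_normD[OF lip] mem) auto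
    finally show "V' s \<le> 2 * L * V s"
      by (simp add: V_def V'_def dot_square_norm power2_eq_square algebra_simps)
  qed
  also have "V t0 = 0"
    using sol by (simp add: V_def is_solution_def)
  finally have "(\<phi> t - \<psi> t) \<bullet> (\<phi> t - \<psi> t) = 0"
    by (intro order_antisym) (simp_all add: V_def)
  then show ?thesis
    by simp
qed

lemma solution_at_eq:
  fixes f :: "'a::real_inner \<Rightarrow> 'a"
  assumes "L-lipschitz_on X f" "is_solution f X t0 x0 \<phi>" "t0 \<le> t"
  shows "solution_at f X t t0 x0 = \<phi> t"
  unfolding solution_at_def
  using assms is_solution_unique by (intro the_equality) blast+

lemma is_solution_shift:
  assumes "is_solution f X 0 x0 \<phi>"
  shows "is_solution f X t0 x0 (\<lambda>t. \<phi> (t - t0))"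
  unfolding is_solution_def
proof (intro conjI allI impI)
  show "\<phi> (t0 - t0) = x0"
    using assms by (simp add: is_solution_def)
  fix t assume "t0 \<le> t"
  then show "\<phi> (t - t0) \<in> X"
    using assms by (simp add: is_solution_def)
  have "(\<lambda>t. t - t0) ` {t0..} \<subseteq> {0..}"
    by auto
  then have "(\<phi> has_vector_derivative f (\<phi> (t - t0))) (at (t - t0) within (\<lambda>t. t - t0) ` {t0..})"
    using assms \<open>t0 \<le> t\<close> by (auto simp: is_solution_def intro: has_vector_derivative_within_subset)
  moreover have "((\<lambda>t. t - t0) has_vector_derivative 1) (at t within {t0..})"
    by (auto intro!: derivative_eq_intros)
  ultimately show "((\<lambda>t. \<phi> (t - t0)) has_vector_derivative f (\<phi> (t - t0))) (at t within {t0..})"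
    using vector_diff_chain_within[of "\<lambda>t. t - t0" 1 t "{t0..}" \<phi>] by (simp add: o_def)
qed

text \<open>With \<open>h\<close> one of the two projections, this extracts solutions of a single system from a solution
  of a system of pairs.\<close>

lemma is_solution_image:
  assumes sol: "is_solution F Y t0 y0 \<Phi>" and h: "bounded_linear h"
    and maps: "\<And>y. y \<in> Y \<Longrightarrow> h y \<in> X" "\<And>y. y \<in> Y \<Longrightarrow> h (F y) = f (h y)"
  shows "is_solution f X t0 (h y0) (\<lambda>t. h (\<Phi> t))"
  unfolding is_solution_def
proof (intro conjI allI impI)
  show "h (\<Phi> t0) = h y0"
    using sol by (simp add: is_solution_def)
  fix t assume "t0 \<le> t"
  then have mem: "\<Phi> t \<in> Y" and der: "(\<Phi> has_vector_derivative F (\<Phi> t)) (at t within {t0..})"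
    using sol by (simp_all add: is_solution_def)
  from mem show "h (\<Phi> t) \<in> X"
    by (rule maps)
  show "((\<lambda>t. h (\<Phi> t)) has_vector_derivative f (h (\<Phi> t))) (at t within {t0..})"
    using bounded_linear.has_vector_derivative[OF h der] maps(2)[OF mem] by simp
qed

section \<open>Solutions that stay in a closed convex cone\<close>

text \<open>Describing a closed convex cone by the half-spaces that contain it makes closure under
  integration immediate: it suffices to integrate each functional \<open>h\<close>.\<close>

definition dual_cone :: "'a::real_inner set \<Rightarrow> 'a set" where
  "dual_cone A = {x. \<forall>h\<in>A. 0 \<le> h \<bullet> x}"

lemma dual_cone_scaleR: "0 \<le> r \<Longrightarrow> x \<in> dual_cone A \<Longrightarrow> r *\<^sub>R x \<in> dual_cone A"
  by (simp add: dual_cone_def)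

lemma dual_cone_add: "x \<in> dual_cone A \<Longrightarrow> y \<in> dual_cone A \<Longrightarrow> x + y \<in> dual_cone A"
  by (simp add: dual_cone_def inner_add_right)

lemma zero_in_dual_cone: "0 \<in> dual_cone A"
  by (simp add: dual_cone_def)

lemma closed_dual_cone: "closed (dual_cone A)"
proof -
  have "dual_cone A = (\<Inter>h\<in>A. {x. 0 \<le> h \<bullet> x})"
    by (auto simp: dual_cone_def)
  then show ?thesis
    by (simp add: closed_INT closed_halfspace_ge)
qed

lemma integral_in_dual_cone:
  fixes F :: "real \<Rightarrow> 'a::euclidean_space"
  assumes "F integrable_on S" "\<And>s. s \<in> S \<Longrightarrow> F s \<in> dual_cone A"
  shows "integral S F \<in> dual_cone A"
  unfolding dual_cone_def
proof (intro CollectI ballI)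
  fix h assume "h \<in> A"
  have "h \<bullet> integral S F = integral S (\<lambda>s. h \<bullet> F s)"
    using integral_linear[OF assms(1) bounded_linear_inner_right[of h]] by (simp add: o_def)
  also have "\<dots> \<ge> 0"
    using assms integrable_linear[OF assms(1) bounded_linear_inner_right[of h]] \<open>h \<in> A\<close>
    by (intro integral_nonneg) (auto simp: o_def dual_cone_def)
  finally show "0 \<le> h \<bullet> integral S F" .
qed

text \<open>Since the shifted field \<open>f x + \<mu> x\<close> maps the cone \<open>X\<close> to itself, the variation-of-constants form
  \<open>\<phi> t = exp (- \<mu> t) (x0 + \<integral> exp (\<mu> s) (f (\<phi> s) + \<mu> \<phi> s) ds)\<close> is built from sums, integrals and
  positive multiples of points of \<open>X\<close>, so Picard iteration never leaves \<open>X\<close>. The fixed point is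
  sought among bounded functions for the rescaled unknown \<open>\<psi> t = exp (- (\<kappa> - \<mu>) t) \<phi> t\<close>. For large
  \<open>\<kappa>\<close> the iteration preserves boundedness on the whole half-line and contracts by a factor \<open>1 / 2\<close>,
  which gives a global solution in one step.\<close>

lemma solution_in_dual_cone_exists:
  fixes f :: "'a::euclidean_space \<Rightarrow> 'a"
  assumes lip: "L-lipschitz_on (dual_cone A) f"
    and qpos: "\<And>x. x \<in> dual_cone A \<Longrightarrow> f x + \<mu> *\<^sub>R x \<in> dual_cone A"
    and x0: "x0 \<in> dual_cone A"
  shows "\<exists>\<phi>. is_solution f (dual_cone A) t0 x0 \<phi>"
proof -
  define X where "X = dual_cone A"
  define H where "H x = f x + \<mu> *\<^sub>R x" for x
  define M where "M = L + \<bar>\<mu>\<bar>"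
  \<comment> \<open>\<open>2 M\<close> yields the contraction factor \<open>1 / 2\<close>; the rest ensures \<open>0 < \<kappa>\<close> and \<open>\<mu> \<le> \<kappa>\<close>.\<close>
  define \<kappa> where "\<kappa> = 2 * M + \<bar>\<mu>\<bar> + 1"
  have "0 \<le> L" using lip by (rule lipschitz_on_nonneg)
  then have "0 \<le> M" "0 < \<kappa>" "\<mu> \<le> \<kappa>" "M / \<kappa> \<le> 1 / 2"
    by (auto simp: M_def \<kappa>_def field_simps)
  have H_lip: "M-lipschitz_on X H"
  proof (rule lipschitz_onI)
    fix x y assume xy: "x \<in> X" "y \<in> X"
    have "norm (H x - H y) = norm ((f x - f y) + \<mu> *\<^sub>R (x - y))"
      by (simp add: H_def algebra_simps)
    also have "\<dots> \<le> norm (f x - f y) + \<bar>\<mu>\<bar> * norm (x - y)"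
      by (rule order_trans[OF norm_triangle_ineq]) simp
    also have "\<dots> \<le> M * norm (x - y)"
      using lipschitz_on_normD[OF lip, of x y] xy by (simp add: M_def X_def algebra_simps)
    finally show "dist (H x) (H y) \<le> M * dist x y"
      by (simp add: dist_norm)
  qed fact
  define K where "K \<psi> s = exp (\<mu> * s) *\<^sub>R H (exp ((\<kappa> - \<mu>) * s) *\<^sub>R apply_bcontfun \<psi> s)"
    for \<psi> :: "real \<Rightarrow>\<^sub>C 'a" and s
  \<comment> \<open>Bounded continuous functions live on the whole line, so times are clamped to be nonnegative.\<close>
  define P where "P \<psi> t = exp (- \<kappa> * max 0 t) *\<^sub>R (x0 + integral {0..max 0 t} (K \<psi>))" for \<psi> t
  define S :: "(real \<Rightarrow>\<^sub>C 'a) set" where "S = PiC UNIV (\<lambda>_. X)"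
  have memS: "\<psi> \<in> S \<longleftrightarrow> (\<forall>t. apply_bcontfun \<psi> t \<in> X)" for \<psi>
    by (auto simp: S_def mem_PiC_iff)
  have arg: "exp r *\<^sub>R apply_bcontfun \<psi> s \<in> X" if "\<psi> \<in> S" for \<psi> r s
    using that unfolding X_def memS by (intro dual_cone_scaleR) auto
  have K_cont: "continuous_on T (K \<psi>)" if "\<psi> \<in> S" for \<psi> T
    unfolding K_def using that
    by (intro continuous_intros continuous_on_compose2[OF lipschitz_on_continuous_on[OF H_lip]])
      (auto simp: arg)
  have K_int: "K \<psi> integrable_on {0..t}" if "\<psi> \<in> S" for \<psi> t
    by (intro integrable_continuous_real K_cont that)
  have K_in: "K \<psi> s \<in> X" if "\<psi> \<in> S" for \<psi> s
    using qpos[of "exp ((\<kappa> - \<mu>) * s) *\<^sub>R apply_bcontfun \<psi> s"] arg[OF that]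
    by (auto simp: K_def X_def H_def intro!: dual_cone_scaleR)
  have exp_int: "((\<lambda>s. exp (\<kappa> * s) * C) has_integral (exp (\<kappa> * t) - 1) / \<kappa> * C) {0..t}"
    if "0 \<le> t" for C t
  proof -
    have "((\<lambda>s. exp (\<kappa> * s) * C) has_integral
        exp (\<kappa> * t) / \<kappa> * C - exp (\<kappa> * 0) / \<kappa> * C) {0..t}"
      using \<open>0 < \<kappa>\<close> that
      by (intro fundamental_theorem_of_calculus)
        (auto intro!: derivative_eq_intros
          simp: has_real_derivative_iff_has_vector_derivative[symmetric])
    then show ?thesis
      by (simp add: algebra_simps diff_divide_distrib)
  qed
  have int_bound: "exp (- \<kappa> * t) * norm (integral {0..t} F) \<le> C / \<kappa>"
    if "0 \<le> t" "0 \<le> C" "F integrable_on {0..t}"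
      "\<And>s. s \<in> {0..t} \<Longrightarrow> norm (F s) \<le> exp (\<kappa> * s) * C" for F :: "real \<Rightarrow> 'a" and C t
  proof -
    have "norm (integral {0..t} F) \<le> (exp (\<kappa> * t) - 1) / \<kappa> * C"
      using integral_norm_bound_integral[OF that(3) _ that(4)] exp_int[OF that(1), of C]
      by (simp add: has_integral_iff)
    then have "exp (- \<kappa> * t) * norm (integral {0..t} F)
        \<le> exp (- \<kappa> * t) * ((exp (\<kappa> * t) - 1) / \<kappa> * C)"
      by (intro mult_left_mono) auto
    also have "\<dots> = (1 - exp (- \<kappa> * t)) * (C / \<kappa>)"
      by (simp add: exp_minus field_simps)
    also have "\<dots> \<le> 1 * (C / \<kappa>)"
      using that \<open>0 < \<kappa>\<close> by (intro mult_right_mono) auto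
    finally show ?thesis by simp
  qed
  have I_deriv: "((\<lambda>t. integral {0..t} (K \<psi>)) has_vector_derivative K \<psi> t) (at t within {0..})"
    if "\<psi> \<in> S" "0 \<le> t" for \<psi> t
  proof -
    have "((\<lambda>t. integral {0..t} (K \<psi>)) has_vector_derivative K \<psi> t) (at t within {0..t + 1})"
      using that by (intro integral_has_vector_derivative K_cont) auto
    moreover have "at t within {0..t + 1} = at t within {0..}"
      by (rule at_within_nhd[of t "{..<t+1}"]) auto
    ultimately show ?thesis
      by simp
  qed
  have P_bcont: "P \<psi> \<in> bcontfun" if "\<psi> \<in> S" for \<psi>
  proof (rule bcontfun_normI)
    have "continuous_on {0..} (\<lambda>t. integral {0..t} (K \<psi>))"
      using I_deriv[OF that] unfolding continuous_on_eq_continuous_within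
      by (auto intro: has_vector_derivative_continuous)
    then have "continuous_on UNIV (\<lambda>t. integral {0..max 0 t} (K \<psi>))"
      by (rule continuous_on_compose2) (auto intro: continuous_intros)
    then show "continuous_on UNIV (P \<psi>)"
      unfolding P_def by (intro continuous_intros)
  next
    fix t
    define C where "C = norm (H 0) + M * norm \<psi>"
    have "0 \<le> C" using \<open>0 \<le> M\<close> by (simp add: C_def)
    have K_bound: "norm (K \<psi> s) \<le> exp (\<kappa> * s) * C" if "s \<in> {0..max 0 t}" for s
    proof -
      let ?y = "exp ((\<kappa> - \<mu>) * s) *\<^sub>R apply_bcontfun \<psi> s"
      have "norm (H ?y) \<le> norm (H 0) + norm (H ?y - H 0)"
        by (rule norm_triangle_sub)
      moreover have "norm (H ?y - H 0) \<le> M * norm (?y - 0)"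
        using arg[OF \<open>\<psi> \<in> S\<close>] zero_in_dual_cone
        by (intro lipschitz_on_normD[OF H_lip]) (auto simp: X_def)
      moreover have "M * norm (?y - 0) \<le> M * (exp ((\<kappa> - \<mu>) * s) * norm \<psi>)"
        using norm_bounded[of \<psi> s] \<open>0 \<le> M\<close> by (intro mult_left_mono) auto
      moreover have "1 * norm (H 0) \<le> exp ((\<kappa> - \<mu>) * s) * norm (H 0)"
        using that \<open>\<mu> \<le> \<kappa>\<close> by (intro mult_right_mono) auto
      ultimately have "norm (H ?y) \<le> exp ((\<kappa> - \<mu>) * s) * C"
        by (simp add: C_def algebra_simps)
      then have "exp (\<mu> * s) * norm (H ?y) \<le> exp (\<mu> * s) * (exp ((\<kappa> - \<mu>) * s) * C)"
        by (rule mult_left_mono) simp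
      then have "norm (K \<psi> s) \<le> exp (\<mu> * s) * (exp ((\<kappa> - \<mu>) * s) * C)"
        by (simp add: K_def)
      then show ?thesis
        by (simp add: exp_diff left_diff_distrib)
    qed
    have "norm (P \<psi> t) \<le> exp (- \<kappa> * max 0 t) * norm x0
        + exp (- \<kappa> * max 0 t) * norm (integral {0..max 0 t} (K \<psi>))"
      by (simp add: P_def norm_triangle_ineq distrib_left[symmetric])
    also have "\<dots> \<le> 1 * norm x0 + C / \<kappa>"
      using \<open>0 < \<kappa>\<close> \<open>0 \<le> C\<close> K_int[OF \<open>\<psi> \<in> S\<close>] K_bound
      by (intro add_mono mult_right_mono int_bound) auto
    finally show "norm (P \<psi> t) \<le> norm x0 + C / \<kappa>"
      by simp
  qed
  have P_in: "P \<psi> t \<in> X" if "\<psi> \<in> S" for \<psi> t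
    unfolding P_def X_def using x0 K_int[OF that] K_in[OF that]
    by (intro dual_cone_scaleR dual_cone_add integral_in_dual_cone) (auto simp: X_def)
  have "\<exists>!\<psi>\<in>S. Bcontfun (P \<psi>) = \<psi>"
  proof (rule Banach_fix[where c = "1/2"])
    show "complete S"
      unfolding S_def X_def complete_eq_closed by (intro closed_PiC closed_dual_cone)
    have "const_bcontfun x0 \<in> S"
      using x0 by (simp add: memS X_def const_bcontfun.rep_eq)
    then show "S \<noteq> {}" by auto
    show "(\<lambda>\<psi>. Bcontfun (P \<psi>)) ` S \<subseteq> S"
      using P_bcont P_in by (auto simp: memS Bcontfun_inverse)
  next
    fix \<psi>1 \<psi>2 assume S: "\<psi>1 \<in> S" "\<psi>2 \<in> S"
    show "dist (Bcontfun (P \<psi>1)) (Bcontfun (P \<psi>2)) \<le> 1/2 * dist \<psi>1 \<psi>2"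
    proof (rule dist_bound)
      fix t :: real
      define \<tau> where "\<tau> = max 0 t"
      have K_diff: "norm (K \<psi>1 s - K \<psi>2 s) \<le> exp (\<kappa> * s) * (M * dist \<psi>1 \<psi>2)" for s
      proof -
        let ?y = "\<lambda>\<psi>. exp ((\<kappa> - \<mu>) * s) *\<^sub>R apply_bcontfun \<psi> s"
        have "norm (K \<psi>1 s - K \<psi>2 s) = exp (\<mu> * s) * norm (H (?y \<psi>1) - H (?y \<psi>2))"
          by (simp add: K_def scaleR_diff_right[symmetric])
        also have "\<dots> \<le> exp (\<mu> * s) * (M * norm (?y \<psi>1 - ?y \<psi>2))"
          by (intro mult_left_mono lipschitz_on_normD[OF H_lip] arg S) auto
        also have "\<dots> = exp (\<kappa> * s) * (M * dist (apply_bcontfun \<psi>1 s) (apply_bcontfun \<psi>2 s))"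
          by (simp add: scaleR_diff_right[symmetric] dist_norm left_diff_distrib exp_diff)
        also have "\<dots> \<le> exp (\<kappa> * s) * (M * dist \<psi>1 \<psi>2)"
          using \<open>0 \<le> M\<close> by (intro mult_left_mono dist_bounded) auto
        finally show ?thesis .
      qed
      have "dist (P \<psi>1 t) (P \<psi>2 t)
          = exp (- \<kappa> * \<tau>) * norm (integral {0..\<tau>} (\<lambda>s. K \<psi>1 s - K \<psi>2 s))"
        by (simp add: P_def \<tau>_def dist_norm scaleR_diff_right[symmetric] integral_diff K_int S)
      also have "\<dots> \<le> (M * dist \<psi>1 \<psi>2) / \<kappa>"
        using \<open>0 \<le> M\<close> K_diff
        by (intro int_bound integrable_diff K_int S) (auto simp: \<tau>_def)
      also have "\<dots> \<le> 1/2 * dist \<psi>1 \<psi>2"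
        using mult_right_mono[OF \<open>M / \<kappa> \<le> 1 / 2\<close>, of "dist \<psi>1 \<psi>2"] by simp
      finally show "dist (apply_bcontfun (Bcontfun (P \<psi>1)) t) (apply_bcontfun (Bcontfun (P \<psi>2)) t)
          \<le> 1/2 * dist \<psi>1 \<psi>2"
        by (simp add: Bcontfun_inverse P_bcont S)
    qed
  qed auto
  then obtain \<psi> where \<psi>: "\<psi> \<in> S" and "Bcontfun (P \<psi>) = \<psi>"
    by auto
  then have fixpt: "apply_bcontfun \<psi> t = P \<psi> t" for t
    by (metis Bcontfun_inverse P_bcont)
  define \<phi> where "\<phi> t = exp ((\<kappa> - \<mu>) * t) *\<^sub>R apply_bcontfun \<psi> t" for t
  have \<phi>_eq: "\<phi> t = exp (- \<mu> * t) *\<^sub>R (x0 + integral {0..t} (K \<psi>))" if "0 \<le> t" for t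
    using that by (simp add: \<phi>_def fixpt P_def exp_add[symmetric] left_diff_distrib)
  have "is_solution f X 0 x0 \<phi>"
    unfolding is_solution_def
  proof (intro conjI allI impI)
    show "\<phi> 0 = x0" by (simp add: \<phi>_eq)
    fix t :: real assume "0 \<le> t"
    show "\<phi> t \<in> X" unfolding \<phi>_def by (rule arg[OF \<psi>])
    note I_deriv[OF \<psi> \<open>0 \<le> t\<close>]
    then have "((\<lambda>t. exp (- \<mu> * t) *\<^sub>R (x0 + integral {0..t} (K \<psi>))) has_vector_derivative
        exp (- \<mu> * t) *\<^sub>R K \<psi> t - \<mu> *\<^sub>R \<phi> t) (at t within {0..})"
      using \<open>0 \<le> t\<close>
      by (auto intro!: derivative_eq_intros simp: \<phi>_eq algebra_simps)
    moreover have "exp (- \<mu> * t) *\<^sub>R K \<psi> t = H (\<phi> t)"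
      by (simp add: K_def \<phi>_def exp_minus)
    ultimately have "((\<lambda>t. exp (- \<mu> * t) *\<^sub>R (x0 + integral {0..t} (K \<psi>))) has_vector_derivative
        f (\<phi> t)) (at t within {0..})"
      by (simp add: H_def)
    then show "(\<phi> has_vector_derivative f (\<phi> t)) (at t within {0..})"
      using \<open>0 \<le> t\<close> by (rule_tac has_vector_derivative_transform) (auto simp: \<phi>_eq)
  qed
  then show ?thesis
    unfolding X_def by (blast intro: is_solution_shift)
qed

section \<open>Norms and the infinitesimal form of contraction\<close>

lemma is_norm_bounded:
  fixes N :: "'a::euclidean_space \<Rightarrow> real"
  assumes "is_norm N"
  shows "\<exists>C. \<forall>v. N v \<le> C * norm v"
proof (intro exI[of _ "\<Sum>b\<in>Basis. N b"] allI)
  have nonneg: "0 \<le> N v" and scale: "N (r *\<^sub>R v) = \<bar>r\<bar> * N v"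
    and triangle: "N (v + w) \<le> N v + N w" and zero: "N 0 = 0" for v w r
    using assms by (auto simp: is_norm_def)
  fix v :: 'a
  have sum_le: "N (sum h B) \<le> (\<Sum>b\<in>B. N (h b))" if "finite B" for h :: "'a \<Rightarrow> 'a" and B
    using that
  proof (induction B rule: finite_induct)
    case (insert x B)
    then show ?case
      using triangle[of "h x" "sum h B"] by simp
  qed (simp add: zero)
  have "N v = N (\<Sum>b\<in>Basis. (v \<bullet> b) *\<^sub>R b)"
    by (simp add: euclidean_representation)
  also have "\<dots> \<le> (\<Sum>b\<in>Basis. N ((v \<bullet> b) *\<^sub>R b))"
    by (rule sum_le) simp
  also have "\<dots> \<le> (\<Sum>b\<in>Basis. norm v * N b)"
    unfolding scale by (intro sum_mono mult_right_mono nonneg Basis_le_norm)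
  finally show "N v \<le> (\<Sum>b\<in>Basis. N b) * norm v"
    by (simp add: sum_distrib_left mult.commute)
qed

text \<open>On a Euclidean space every norm in the sense of \<^const>\<open>is_norm\<close> is Lipschitz for the Euclidean
  norm.\<close>

lemma is_norm_tendsto:
  fixes N :: "'a::euclidean_space \<Rightarrow> real"
  assumes N: "is_norm N" and lim: "(h \<longlongrightarrow> v) F"
  shows "((\<lambda>t. N (h t)) \<longlongrightarrow> N v) F"
proof -
  obtain C where C: "\<And>v. N v \<le> C * norm v"
    using is_norm_bounded[OF N] by blast
  have triangle: "N (v + w) \<le> N v + N w" for v w
    using N by (simp add: is_norm_def)
  have bound: "norm (N w - N v) \<le> C * norm (w - v)" for w
    using triangle[of "w - v" v] triangle[of "v - w" w] C[of "w - v"] C[of "v - w"]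
    unfolding norm_minus_commute[of v w] real_norm_def diff_add_cancel by linarith
  have "\<forall>\<^sub>F t in F. norm (N (h t) - N v) \<le> C * norm (h t - v)"
    by (intro always_eventually allI bound)
  moreover have "((\<lambda>t. C * norm (h t - v)) \<longlongrightarrow> 0) F"
    using lim by (intro tendsto_mult_right_zero tendsto_norm_zero LIM_zero)
  ultimately have "((\<lambda>t. N (h t) - N v) \<longlongrightarrow> 0) F"
    by (rule Lim_null_comparison)
  then show ?thesis
    by (rule LIM_zero_cancel)
qed

text \<open>By the triangle inequality \<open>(1 - exp (- c t)) N(a - b)\<close> is at most \<open>N\<close> of the displacement of the
  difference of the two solutions; dividing by \<open>t\<close> and letting \<open>t\<close> tend to \<open>0\<close> gives the claim.\<close>

lemma contraction_rate_le_field: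
  fixes N :: "'a::euclidean_space \<Rightarrow> real"
  assumes N: "is_norm N"
    and sol: "is_solution f X 0 a \<phi>" "is_solution f X 0 b \<psi>"
    and contr: "\<And>t. 0 \<le> t \<Longrightarrow> N (\<phi> t - \<psi> t) \<le> exp (- t * c) * N (a - b)"
  shows "c * N (a - b) \<le> N (f a - f b)"
proof (rule tendsto_le[OF trivial_limit_at_right_real])
  define R where "R t = ((\<phi> t - \<psi> t) - (a - b)) /\<^sub>R t" for t
  have scale: "N (r *\<^sub>R v) = \<bar>r\<bar> * N v" and triangle: "N (v + w) \<le> N v + N w" for v w r
    using N by (auto simp: is_norm_def)
  have init: "\<phi> 0 = a" "\<psi> 0 = b"
    and deriv: "(\<phi> has_vector_derivative f (\<phi> 0)) (at 0 within {0..})"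
      "(\<psi> has_vector_derivative f (\<psi> 0)) (at 0 within {0..})"
    using sol unfolding is_solution_def by blast+
  have "((\<lambda>t. \<phi> t - \<psi> t) has_vector_derivative f a - f b) (at 0 within {0..})"
    using has_vector_derivative_diff[OF deriv] unfolding init .
  then have "((\<lambda>t. (((\<phi> t - \<psi> t) - (a - b)) - t *\<^sub>R (f a - f b)) /\<^sub>R \<bar>t\<bar>) \<longlongrightarrow> 0) (at_right 0)"
    unfolding has_vector_derivative_def has_derivative_at_within at_within_Ici_at_right
    by (simp add: init)
  moreover have "\<forall>\<^sub>F t in at_right 0.
      (((\<phi> t - \<psi> t) - (a - b)) - t *\<^sub>R (f a - f b)) /\<^sub>R \<bar>t\<bar> = R t - (f a - f b)"
    unfolding eventually_at_filter
    by (intro always_eventually) (simp add: R_def scaleR_diff_right[of "inverse _"])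
  ultimately have "((\<lambda>t. R t - (f a - f b)) \<longlongrightarrow> 0) (at_right 0)"
    by (rule Lim_transform_eventually)
  then have "(R \<longlongrightarrow> f a - f b) (at_right 0)"
    by (rule LIM_zero_cancel)
  then show "((\<lambda>t. N (R t)) \<longlongrightarrow> N (f a - f b)) (at_right 0)"
    by (rule is_norm_tendsto[OF N])
  have "((\<lambda>t. exp (- t * c)) has_real_derivative - c) (at 0 within {0..})"
    by (auto intro!: derivative_eq_intros)
  then have "((\<lambda>t. (exp (- t * c) - 1) / t) \<longlongrightarrow> - c) (at_right 0)"
    by (simp add: has_field_derivative_iff at_within_Ici_at_right)
  then have "((\<lambda>t. - ((exp (- t * c) - 1) / t) * N (a - b)) \<longlongrightarrow> - (- c) * N (a - b)) (at_right 0)"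
    by (intro tendsto_mult_right tendsto_minus)
  then show "((\<lambda>t. (1 - exp (- t * c)) / t * N (a - b)) \<longlongrightarrow> c * N (a - b)) (at_right 0)"
    by (simp add: diff_divide_distrib)
  have "(1 - exp (- t * c)) / t * N (a - b) \<le> N (R t)" if "0 < t" for t
  proof -
    have "N (a - b) \<le> N (\<phi> t - \<psi> t) + N ((- t) *\<^sub>R R t)"
      using triangle[of "\<phi> t - \<psi> t" "(- t) *\<^sub>R R t"] that by (simp add: R_def)
    also have "N ((- t) *\<^sub>R R t) = t * N (R t)"
      using that by (simp only: scale)
    finally have "(1 - exp (- t * c)) * N (a - b) \<le> t * N (R t)"
      using contr[of t] that by (simp add: left_diff_distrib)
    then show ?thesis
      using that by (simp add: field_simps)
  qed
  then show "\<forall>\<^sub>F t in at_right 0. (1 - exp (- t * c)) / t * N (a - b) \<le> N (R t)"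
    by (auto simp: eventually_at_filter)
qed

section \<open>The orthant and the feedback function\<close>

lemma mem_nonneg_orthant: "x \<in> nonneg_orthant \<longleftrightarrow> 0 \<le> x"
  by (simp add: nonneg_orthant_def less_eq_vec_def)

lemma g_diff:
  assumes "1 < k" "0 \<le> u" "0 \<le> v"
  shows "g k v - g k u = (k - 1) * (v - u) / ((k + u) * (k + v))"
  using assms by (simp add: g_def field_simps)

lemma g_diff_bounds:
  assumes "1 < k" "0 \<le> \<eta>" "\<eta> \<le> u" "u \<le> v"
  shows "0 \<le> g k v - g k u" "g k v - g k u \<le> (k - 1) / (k + \<eta>)\<^sup>2 * (v - u)"
proof -
  have eq: "g k v - g k u = (k - 1) * (v - u) / ((k + u) * (k + v))"
    using assms by (intro g_diff) auto
  show "0 \<le> g k v - g k u"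
    unfolding eq using assms by auto
  have "(k + \<eta>)\<^sup>2 \<le> (k + u) * (k + v)"
    unfolding power2_eq_square using assms by (intro mult_mono) auto
  moreover have "0 < (k + \<eta>)\<^sup>2"
    using assms by simp
  ultimately show "g k v - g k u \<le> (k - 1) / (k + \<eta>)\<^sup>2 * (v - u)"
    unfolding eq using assms by (simp add: frac_le)
qed

lemma g_slope_le_1: "1 < k \<Longrightarrow> (k - 1) / k\<^sup>2 \<le> (1::real)"
  using zero_le_power2[of "k - 1"] by (simp add: power2_eq_square field_simps)

lemma g_lipschitz:
  assumes "1 < k" "0 \<le> u" "0 \<le> v"
  shows "\<bar>g k v - g k u\<bar> \<le> \<bar>v - u\<bar>"
proof -
  have "\<bar>g k v - g k u\<bar> \<le> v - u" if "0 \<le> u" "u \<le> v" for u v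
  proof -
    have "g k v - g k u \<le> (k - 1) / k\<^sup>2 * (v - u)"
      using g_diff_bounds(2)[of k 0 u v] assms(1) that by simp
    also have "\<dots> \<le> 1 * (v - u)"
      using g_slope_le_1[OF assms(1)] that by (intro mult_right_mono) auto
    finally show ?thesis
      using g_diff_bounds(1)[of k 0 u v] assms(1) that by simp
  qed
  from this[of u v] this[of v u] show ?thesis
    using assms by (cases "u \<le> v") auto
qed

section \<open>The cyclic system and its monotone flow\<close>

text \<open>The dimension is a parameter \<open>n\<close> with \<open>n = CARD('n)\<close> rather than an abbreviation, which would
  carry the index type as an argument.\<close>

locale cyclic_system =
  fixes e :: "nat \<Rightarrow> 'n::finite" and \<alpha> :: "nat \<Rightarrow> real" and k :: real and n :: nat
  assumes n_eq: "n = CARD('n)"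
    and n_ge_2: "2 \<le> n"
    and bij: "bij_betw e {1..n} UNIV"
    and \<alpha>_pos: "\<And>i. i \<in> {1..n} \<Longrightarrow> 0 < \<alpha> i"
    and k_gt_1: "1 < k"
begin

abbreviation f :: "real ^ 'n \<Rightarrow> real ^ 'n" where "f \<equiv> vector_field e \<alpha> k"

abbreviation orthant :: "(real ^ 'n) set" where "orthant \<equiv> nonneg_orthant"

abbreviation flow :: "real \<Rightarrow> real \<Rightarrow> real ^ 'n \<Rightarrow> real ^ 'n" where
  "flow \<equiv> solution_at f orthant"

lemmas f_first = vector_field_nth(1)[OF bij[unfolded n_eq], of \<alpha> k, folded n_eq, unfolded One_nat_def]
lemmas f_later = vector_field_nth(2)[OF bij[unfolded n_eq], of _ \<alpha> k, folded n_eq]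

lemma index_cases:
  obtains "j = e 1" | i where "i \<in> {2..n}" "j = e i"
proof -
  obtain i where i: "i \<in> {1..n}" "j = e i"
    using bij_betw_imp_surj_on[OF bij] by blast
  show ?thesis
  proof (cases "i = 1")
    case True
    then show ?thesis using i that(1) by simp
  next
    case False
    then show ?thesis using i that(2)[of i] by auto
  qed
qed

lemma e_inj: "i \<in> {1..n} \<Longrightarrow> j \<in> {1..n} \<Longrightarrow> e i = e j \<longleftrightarrow> i = j"
  using bij inj_on_eq_iff unfolding bij_betw_def by metis

text \<open>As an upper bound of the \<open>\<alpha> i\<close>, it lets \<open>f x + \<mu> x\<close> absorb the decay terms, which leaves a map that
  is monotone on the orthant.\<close>

definition \<mu> :: real where "\<mu> = (\<Sum>i=1..n. \<alpha> i)"

lemma \<alpha>_le_\<mu>: "i \<in> {1..n} \<Longrightarrow> \<alpha> i \<le> \<mu>"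
  unfolding \<mu>_def by (intro member_le_sum less_imp_le[OF \<alpha>_pos]) auto

lemma f_lipschitz: "\<exists>L. L-lipschitz_on orthant f"
proof
  have "0 < \<mu>"
    using \<alpha>_pos[of 1] \<alpha>_le_\<mu>[of 1] n_ge_2 by auto
  show "(real n * (1 + \<mu>))-lipschitz_on orthant f"
  proof (rule lipschitz_onI)
    fix a b :: "real ^ 'n" assume ab: "a \<in> orthant" "b \<in> orthant"
    have comp: "\<bar>(f a - f b) $ j\<bar> \<le> (1 + \<mu>) * norm (a - b)" for j
    proof -
      have decay: "\<bar>\<alpha> i * a $ e i - \<alpha> i * b $ e i\<bar> \<le> \<mu> * norm (a - b)" if "i \<in> {1..n}" for i
      proof -
        have "\<bar>\<alpha> i * a $ e i - \<alpha> i * b $ e i\<bar> = \<alpha> i * \<bar>(a - b) $ e i\<bar>"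
          using \<alpha>_pos[OF that] by (simp add: right_diff_distrib[symmetric] abs_mult)
        also have "\<dots> \<le> \<mu> * norm (a - b)"
          using \<alpha>_le_\<mu>[OF that] \<open>0 < \<mu>\<close> by (intro mult_mono component_le_norm_cart) auto
        finally show ?thesis .
      qed
      show ?thesis
      proof (cases j rule: index_cases)
        case 1
        have "\<bar>g k (a $ e n) - g k (b $ e n)\<bar> \<le> \<bar>(a - b) $ e n\<bar>"
          using g_lipschitz[OF k_gt_1] ab by (simp add: nonneg_orthant_def)
        also have "\<dots> \<le> norm (a - b)"
          by (rule component_le_norm_cart)
        finally show ?thesis
          using decay[of 1] n_ge_2 by (simp add: 1 f_first distrib_right)
      next
        case (2 i)
        have "\<bar>(a - b) $ e (i - 1)\<bar> \<le> norm (a - b)"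
          by (rule component_le_norm_cart)
        then show ?thesis
          using decay[of i] 2 by (simp add: f_later distrib_right)
      qed
    qed
    have "norm (f a - f b) \<le> (\<Sum>j\<in>UNIV. \<bar>(f a - f b) $ j\<bar>)"
      by (rule norm_le_l1_cart)
    also have "\<dots> \<le> (\<Sum>j\<in>(UNIV :: 'n set). (1 + \<mu>) * norm (a - b))"
      by (intro sum_mono comp)
    finally show "dist (f a) (f b) \<le> real n * (1 + \<mu>) * dist a b"
      by (simp add: dist_norm n_eq)
  qed (use \<open>0 < \<mu>\<close> in auto)
qed

lemma f_quasimonotone:
  assumes "0 \<le> a" "a \<le> b"
  shows "f a + \<mu> *\<^sub>R a \<le> f b + \<mu> *\<^sub>R b"
  unfolding less_eq_vec_def
proof
  fix j
  have ab: "0 \<le> a $ j" "a $ j \<le> b $ j" for j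
    using assms by (auto simp: less_eq_vec_def)
  have decay: "\<mu> * a $ e i - \<alpha> i * a $ e i \<le> \<mu> * b $ e i - \<alpha> i * b $ e i" if "i \<in> {1..n}" for i
    using mult_left_mono[OF ab(2)[of "e i"], of "\<mu> - \<alpha> i"] \<alpha>_le_\<mu>[OF that]
    by (simp add: left_diff_distrib)
  show "(f a + \<mu> *\<^sub>R a) $ j \<le> (f b + \<mu> *\<^sub>R b) $ j"
  proof (cases j rule: index_cases)
    case 1
    then show ?thesis
      using decay[of 1] n_ge_2 g_diff_bounds(1)[OF k_gt_1 order_refl ab, of "e n"]
      by (simp add: f_first)
  next
    case (2 i)
    then show ?thesis
      using decay[of i] ab(2)[of "e (i - 1)"] by (simp add: f_later)
  qed
qed

lemma f_quasipositive:
  assumes "0 \<le> a"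
  shows "0 \<le> f a + \<mu> *\<^sub>R a"
proof -
  have "0 \<le> f 0"
    unfolding less_eq_vec_def
  proof
    fix j show "(0 :: real ^ 'n) $ j \<le> f 0 $ j"
      by (cases j rule: index_cases) (use k_gt_1 in \<open>auto simp: f_first f_later g_def\<close>)
  qed
  also have "f 0 \<le> f a + \<mu> *\<^sub>R a"
    using f_quasimonotone[of 0 a] assms by simp
  finally show ?thesis .
qed

text \<open>The pairs \<open>0 \<le> a \<le> b\<close> form a dual cone that two copies of the shifted field map to itself. So
  a single solution on it provides both solutions together with their order.\<close>

lemma ordered_solutions_exist:
  assumes "0 \<le> a" "a \<le> b"
  obtains \<phi> \<psi> where "is_solution f orthant t0 a \<phi>" "is_solution f orthant t0 b \<psi>"
    "\<And>t. t0 \<le> t \<Longrightarrow> \<phi> t \<le> \<psi> t"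
proof -
  define A :: "((real ^ 'n) \<times> (real ^ 'n)) set" where
    "A = range (\<lambda>j. (axis j 1, 0)) \<union> range (\<lambda>j. (- axis j 1, axis j 1))"
  define F where "F p = (f (fst p), f (snd p))" for p
  have cone: "p \<in> dual_cone A \<longleftrightarrow> 0 \<le> fst p \<and> fst p \<le> snd p" for p
    by (cases p) (auto simp: dual_cone_def A_def ball_Un less_eq_vec_def inner_axis')
  have orth: "fst p \<in> orthant" "snd p \<in> orthant" if "p \<in> dual_cone A" for p
    using that order_trans[of 0 "fst p" "snd p"] by (simp_all add: cone mem_nonneg_orthant)
  obtain L where lip: "L-lipschitz_on orthant f"
    using f_lipschitz by blast
  have "0 \<le> L" using lip by (rule lipschitz_on_nonneg)
  have F_lip: "L-lipschitz_on (dual_cone A) F"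
  proof (rule lipschitz_onI)
    fix p q assume "p \<in> dual_cone A" "q \<in> dual_cone A"
    then have "dist (F p) (F q) \<le> sqrt ((L * dist (fst p) (fst q))\<^sup>2 + (L * dist (snd p) (snd q))\<^sup>2)"
      unfolding F_def dist_Pair_Pair
      by (intro real_sqrt_le_mono add_mono power_mono lipschitz_onD[OF lip] orth) auto
    also have "\<dots> = L * dist p q"
      using \<open>0 \<le> L\<close> by (simp add: dist_prod_def power_mult_distrib distrib_left[symmetric] real_sqrt_mult)
    finally show "dist (F p) (F q) \<le> L * dist p q" .
  qed fact
  have "\<exists>\<Phi>. is_solution F (dual_cone A) t0 (a, b) \<Phi>"
  proof (rule solution_in_dual_cone_exists[OF F_lip, where \<mu> = \<mu>])
    show "F p + \<mu> *\<^sub>R p \<in> dual_cone A" if "p \<in> dual_cone A" for p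
      using that f_quasimonotone f_quasipositive by (simp add: cone F_def)
    show "(a, b) \<in> dual_cone A"
      using assms by (simp add: cone)
  qed
  then obtain \<Phi> where \<Phi>: "is_solution F (dual_cone A) t0 (a, b) \<Phi>" ..
  show thesis
  proof (rule that)
    show "is_solution f orthant t0 a (\<lambda>t. fst (\<Phi> t))"
      using is_solution_image[OF \<Phi> bounded_linear_fst, of orthant f] orth by (simp add: F_def)
    show "is_solution f orthant t0 b (\<lambda>t. snd (\<Phi> t))"
      using is_solution_image[OF \<Phi> bounded_linear_snd, of orthant f] orth by (simp add: F_def)
    show "fst (\<Phi> t) \<le> snd (\<Phi> t)" if "t0 \<le> t" for t
      using \<Phi> that by (auto simp: is_solution_def cone)
  qed
qed

lemma flow_eq: "is_solution f orthant t0 a \<phi> \<Longrightarrow> t0 \<le> t \<Longrightarrow> flow t t0 a = \<phi> t"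
  using f_lipschitz solution_at_eq by blast

lemma solution_init: "is_solution f orthant t0 a \<phi> \<Longrightarrow> \<phi> t0 = a"
  by (simp add: is_solution_def)

lemma solution_nonneg: "is_solution f orthant t0 a \<phi> \<Longrightarrow> t0 \<le> t \<Longrightarrow> 0 \<le> \<phi> t $ j"
  by (simp add: is_solution_def nonneg_orthant_def)

lemma solution_nth_deriv:
  assumes "is_solution f orthant t0 a \<phi>" "t0 \<le> s" "s \<le> t"
  shows "((\<lambda>t. \<phi> t $ j) has_real_derivative f (\<phi> t) $ j) (at t within {s..})"
  unfolding has_real_derivative_iff_has_vector_derivative
proof (rule bounded_linear.has_vector_derivative[OF bounded_linear_vec_nth])
  show "(\<phi> has_vector_derivative f (\<phi> t)) (at t within {s..})"
    using assms has_vector_derivative_within_subset[of \<phi> "f (\<phi> t)" t "{t0..}" "{s..}"]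
    by (simp add: is_solution_def)
qed

section \<open>Weighted norms that decay along the flow\<close>

text \<open>These weights solve \<open>w\<^sub>i\<^sub>+\<^sub>1 = (\<alpha>\<^sub>i - c) w\<^sub>i\<close>, which makes all but one column of the weighted
  Jacobian balance exactly at rate \<open>c\<close>. At \<open>c = 0\<close> they form, in the critical case, a left kernel vector
  of the Jacobian at the origin.\<close>

definition weight :: "real \<Rightarrow> nat \<Rightarrow> real" where
  "weight c i = (\<Prod>j=1..<i. \<alpha> j - c)"

definition wnorm :: "real \<Rightarrow> real ^ 'n \<Rightarrow> real" where
  "wnorm c v = (\<Sum>i=1..n. weight c i * \<bar>v $ e i\<bar>)"

definition admissible :: "real \<Rightarrow> bool" where
  "admissible c \<longleftrightarrow> (\<forall>i\<in>{1..n}. c < \<alpha> i)"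

lemma weight_pos: "admissible c \<Longrightarrow> i \<in> {1..n} \<Longrightarrow> 0 < weight c i"
  unfolding weight_def admissible_def by (intro prod_pos) auto

lemma wnorm_mono:
  assumes "\<And>i. i \<in> {1..n} \<Longrightarrow> weight c i \<le> r * weight d i"
  shows "wnorm c v \<le> r * wnorm d v"
  unfolding wnorm_def sum_distrib_left mult.assoc[symmetric]
  using assms by (intro sum_mono mult_right_mono) auto

lemma is_norm_wnorm:
  assumes "admissible c"
  shows "is_norm (wnorm c)"
  unfolding is_norm_def
proof (intro conjI allI)
  note w = less_imp_le[OF weight_pos[OF assms]]
  fix x y :: "real ^ 'n" and r :: real
  show "0 \<le> wnorm c x"
    unfolding wnorm_def using w by (intro sum_nonneg mult_nonneg_nonneg) auto
  show "wnorm c (r *\<^sub>R x) = \<bar>r\<bar> * wnorm c x"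
    by (simp add: wnorm_def abs_mult sum_distrib_left mult.left_commute)
  show "wnorm c (x + y) \<le> wnorm c x + wnorm c y"
    unfolding wnorm_def sum.distrib[symmetric] distrib_left[symmetric]
    using w by (intro sum_mono mult_left_mono) auto
  show "wnorm c x = 0 \<longleftrightarrow> x = 0"
  proof
    assume "wnorm c x = 0"
    then have "weight c i * \<bar>x $ e i\<bar> = 0" if "i \<in> {1..n}" for i
      unfolding wnorm_def using w that by (subst (asm) sum_nonneg_eq_0_iff) auto
    then have "x $ e i = 0" if "i \<in> {1..n}" for i
      using that weight_pos[OF assms that] by force
    then show "x = 0"
      unfolding vec_eq_iff using n_ge_2 by (metis (no_types) UNIV_I bij bij_betw_def imageE zero_index)
  qed (simp add: wnorm_def)
qed

text \<open>The outflow of coordinate \<open>i\<close> is the inflow of coordinate \<open>i + 1\<close>, so up to the decay \<open>- c V\<close> the sum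
  telescopes and only the feedback from coordinate \<open>n\<close> to coordinate \<open>1\<close> remains.\<close>

lemma weighted_field_difference:
  "(\<Sum>i=1..n. weight c i * (f y - f x) $ e i) =
    (g k (y $ e n) - g k (x $ e n)) - (\<Prod>i=1..n. \<alpha> i - c) * (y - x) $ e n
      - c * (\<Sum>i=1..n. weight c i * (y - x) $ e i)"
proof -
  have "m \<le> n \<longrightarrow> (\<Sum>i=1..m. weight c i * (f y - f x) $ e i) =
      (g k (y $ e n) - g k (x $ e n)) - weight c (Suc m) * (y - x) $ e m
        - c * (\<Sum>i=1..m. weight c i * (y - x) $ e i)" if "1 \<le> m" for m
    using that
  proof (induction m rule: nat_induct_at_least)
    case base
    then show ?case
      by (simp add: weight_def f_first algebra_simps)
  next
    case (Suc m)
    have "weight c (Suc (Suc m)) = weight c (Suc m) * (\<alpha> (Suc m) - c)"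
      by (simp add: weight_def prod.atLeastLessThan_Suc)
    moreover have "(f y - f x) $ e (Suc m) = (y - x) $ e m - \<alpha> (Suc m) * (y - x) $ e (Suc m)"
      if "Suc m \<le> n"
      using f_later[of "Suc m"] that Suc.hyps by (simp add: right_diff_distrib)
    ultimately show ?case
      using Suc.IH Suc.hyps
      by (simp del: vector_minus_component add: distrib_left right_diff_distrib left_diff_distrib)
  qed
  from this[of n] show ?thesis
    using n_ge_2 by (simp add: weight_def atLeastLessThanSuc_atLeastAtMost)
qed

text \<open>The bound \<open>\<eta>\<close> on the smaller solution controls the slope of \<open>g\<close> between the two, and the hypothesis
  on \<open>c\<close> is exactly what makes the remainder in the telescoped sum nonpositive.\<close>

lemma ordered_solutions_contract:
  assumes sol: "is_solution f orthant t0 a \<phi>" "is_solution f orthant t0 b \<psi>"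
    and ord: "\<And>t. t0 \<le> t \<Longrightarrow> \<phi> t \<le> \<psi> t"
    and lower: "0 \<le> \<eta>" "\<And>t. s \<le> t \<Longrightarrow> \<eta> \<le> \<phi> t $ e n"
    and c: "(k - 1) / (k + \<eta>)\<^sup>2 \<le> (\<Prod>i=1..n. \<alpha> i - c)"
    and "t0 \<le> s" "s \<le> t"
  shows "wnorm c (\<psi> t - \<phi> t) \<le> exp (- (t - s) * c) * wnorm c (\<psi> s - \<phi> s)"
proof -
  define V where "V t = (\<Sum>i=1..n. weight c i * (\<psi> t - \<phi> t) $ e i)" for t
  define V' where "V' t = (\<Sum>i=1..n. weight c i * (f (\<psi> t) - f (\<phi> t)) $ e i)" for t
  have V_eq: "wnorm c (\<psi> t - \<phi> t) = V t" if "t0 \<le> t" for t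
    using ord[OF that] by (simp add: V_def wnorm_def less_eq_vec_def)
  have "V t \<le> exp (- c * (t - s)) * V s"
  proof (rule exp_growth_bound[OF _ _ \<open>s \<le> t\<close>])
    fix r assume r: "s \<le> r"
    show "(V has_real_derivative V' r) (at r within {s..})"
      unfolding V_def V'_def
      by (auto intro!: derivative_eq_intros solution_nth_deriv[OF sol(1) \<open>t0 \<le> s\<close> r]
          solution_nth_deriv[OF sol(2) \<open>t0 \<le> s\<close> r] sum.cong)
    have le: "\<phi> r $ e n \<le> \<psi> r $ e n"
      using ord[of r] r \<open>t0 \<le> s\<close> by (simp add: less_eq_vec_def)
    have "g k (\<psi> r $ e n) - g k (\<phi> r $ e n) \<le> (k - 1) / (k + \<eta>)\<^sup>2 * (\<psi> r $ e n - \<phi> r $ e n)"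
      using lower r le by (intro g_diff_bounds k_gt_1) auto
    also have "\<dots> \<le> (\<Prod>i=1..n. \<alpha> i - c) * (\<psi> r $ e n - \<phi> r $ e n)"
      using le by (intro mult_right_mono c) auto
    finally show "V' r \<le> - c * V r"
      unfolding V'_def weighted_field_difference by (simp add: V_def)
  qed
  moreover have "- (t - s) * c = - c * (t - s)"
    by (simp add: algebra_simps)
  ultimately show ?thesis
    using V_eq \<open>t0 \<le> s\<close> \<open>s \<le> t\<close> by (simp only: order_trans[of t0 s t])
qed

text \<open>Both points lie below their componentwise maximum \<open>m\<close>, and
  \<open>\<bar>m\<^sub>i - a\<^sub>i\<bar> + \<bar>m\<^sub>i - b\<^sub>i\<bar> = \<bar>a\<^sub>i - b\<^sub>i\<bar>\<close>, so nothing is lost by going through \<open>m\<close>.\<close>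

lemma wnorm_bound_from_ordered:
  assumes adm: "admissible c"
    and ordered: "\<And>a b. 0 \<le> a \<Longrightarrow> a \<le> b \<Longrightarrow> wnorm c (S b - S a) \<le> r * wnorm c (b - a)"
    and ab: "a \<in> orthant" "b \<in> orthant"
  shows "wnorm c (S a - S b) \<le> r * wnorm c (a - b)"
proof -
  define m :: "real ^ 'n" where "m = (\<chi> j. max (a $ j) (b $ j))"
  have m: "a \<le> m" "b \<le> m" "0 \<le> a" "0 \<le> b"
    using ab by (auto simp: m_def less_eq_vec_def nonneg_orthant_def)
  have minus: "wnorm c (u - v) = wnorm c (v - u)" for u v
    by (simp add: wnorm_def abs_minus_commute)
  have triangle: "wnorm c (u + v) \<le> wnorm c u + wnorm c v" for u v
    using is_norm_wnorm[OF adm] by (simp add: is_norm_def)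
  have "wnorm c (S a - S b) \<le> wnorm c (S a - S m) + wnorm c (S m - S b)"
    using triangle[of "S a - S m" "S m - S b"] by simp
  also have "\<dots> \<le> r * wnorm c (m - a) + r * wnorm c (m - b)"
    using ordered m by (simp add: minus[of "S a"] add_mono)
  also have "\<dots> = r * (wnorm c (m - a) + wnorm c (m - b))"
    by (simp add: distrib_left)
  also have "wnorm c (m - a) + wnorm c (m - b) = wnorm c (a - b)"
    unfolding wnorm_def sum.distrib[symmetric] distrib_left[symmetric]
    by (intro sum.cong) (auto simp: m_def max_def)
  finally show ?thesis .
qed

lemma flow_contracts:
  assumes "admissible c" "(k - 1) / k\<^sup>2 \<le> (\<Prod>i=1..n. \<alpha> i - c)" "t1 \<le> t2"
    "a \<in> orthant" "b \<in> orthant"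
  shows "wnorm c (flow t2 t1 a - flow t2 t1 b) \<le> exp (- (t2 - t1) * c) * wnorm c (a - b)"
proof (rule wnorm_bound_from_ordered)
  fix a b :: "real ^ 'n" assume ab: "0 \<le> a" "a \<le> b"
  obtain \<phi> \<psi> where sol: "is_solution f orthant t1 a \<phi>" "is_solution f orthant t1 b \<psi>"
    and ord: "\<And>t. t1 \<le> t \<Longrightarrow> \<phi> t \<le> \<psi> t"
    using ordered_solutions_exist[OF ab] by metis
  have "wnorm c (\<psi> t2 - \<phi> t2) \<le> exp (- (t2 - t1) * c) * wnorm c (\<psi> t1 - \<phi> t1)"
    using assms by (intro ordered_solutions_contract[OF sol ord, of 0] solution_nonneg[OF sol(1)]) auto
  then show "wnorm c (flow t2 t1 b - flow t2 t1 a) \<le> exp (- (t2 - t1) * c) * wnorm c (b - a)"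
    using solution_init[OF sol(1)] solution_init[OF sol(2)] flow_eq[OF sol(1) \<open>t1 \<le> t2\<close>]
      flow_eq[OF sol(2) \<open>t1 \<le> t2\<close>] by simp
qed (use assms in auto)

section \<open>The subcritical case\<close>

lemma eventually_admissible: "\<forall>\<^sub>F c in at_right 0. admissible c"
  unfolding admissible_def
proof (rule eventually_ball_finite)
  show "\<forall>i\<in>{1..n}. \<forall>\<^sub>F c in at_right 0. c < \<alpha> i"
    using \<alpha>_pos by (auto intro: eventually_at_right_less order_tendstoD(2)[OF tendsto_ident_at])
qed auto

lemma eventually_less_prod:
  assumes "r < (\<Prod>i=1..n. \<alpha> i)"
  shows "\<forall>\<^sub>F c in at_right 0. r < (\<Prod>i=1..n. \<alpha> i - c)"
proof (rule order_tendstoD(1))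
  show "((\<lambda>c. \<Prod>i=1..n. \<alpha> i - c) \<longlongrightarrow> (\<Prod>i=1..n. \<alpha> i - 0)) (at_right 0)"
    by (intro tendsto_intros)
qed (use assms in simp)

lemma contractive_if_subcritical:
  assumes "(k - 1) / k\<^sup>2 < (\<Prod>i=1..n. \<alpha> i)"
  shows "\<exists>N. is_norm N \<and> contractive_on flow orthant N"
proof -
  have "\<forall>\<^sub>F c in at_right 0. 0 < c \<and> admissible c \<and> (k - 1) / k\<^sup>2 < (\<Prod>i=1..n. \<alpha> i - c)"
    by (intro eventually_conj eventually_at_right_less eventually_admissible
        eventually_less_prod assms)
  then obtain c where c: "0 < c" "admissible c" "(k - 1) / k\<^sup>2 < (\<Prod>i=1..n. \<alpha> i - c)"
    using eventually_happens trivial_limit_at_right_real by blast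
  have "contractive_on flow orthant (wnorm c)"
    unfolding contractive_on_def using c(1) flow_contracts[OF c(2) less_imp_le[OF c(3)]] by blast
  then show ?thesis
    using is_norm_wnorm[OF c(2)] by blast
qed

section \<open>Overshoot estimate in the critical case\<close>

text \<open>Production \<open>g \<ge> 1 / k\<close> lifts the first coordinate, and each coordinate, once bounded below, lifts
  the next one after one further unit of time. The point is that \<open>\<eta>\<close> depends neither on the initial
  time nor on the initial value.\<close>

lemma coordinate_lower_bound:
  assumes "1 \<le> i" "i \<le> n"
  shows "\<exists>\<eta>>0. \<forall>t0 a \<phi> t. is_solution f orthant t0 a \<phi> \<longrightarrow> t0 + real i \<le> t \<longrightarrow> \<eta> \<le> \<phi> t $ e i"
proof -
  \<comment> \<open>An input of at least \<open>\<beta>\<close> from time \<open>t0 + i - 1\<close> on bounds coordinate \<open>i\<close> from time \<open>t0 + i\<close> on.\<close>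
  have step: "\<exists>\<eta>>0. \<forall>t0 a \<phi> t. is_solution f orthant t0 a \<phi> \<longrightarrow> t0 + real i \<le> t \<longrightarrow> \<eta> \<le> \<phi> t $ e i"
    if i: "i \<in> {1..n}" and "0 < \<beta>"
      and input: "\<And>t0 a \<phi> t. is_solution f orthant t0 a \<phi> \<Longrightarrow> t0 + real (i - 1) \<le> t
        \<Longrightarrow> \<beta> - \<alpha> i * \<phi> t $ e i \<le> f (\<phi> t) $ e i" for i \<beta>
  proof (intro exI[of _ "\<beta> / \<alpha> i * (1 - exp (- \<alpha> i))"] conjI allI impI)
    show "0 < \<beta> / \<alpha> i * (1 - exp (- \<alpha> i))"
      using \<open>0 < \<beta>\<close> \<alpha>_pos[OF i] by simp
    fix t0 a \<phi> t assume sol: "is_solution f orthant t0 a \<phi>" and t: "t0 + real i \<le> t"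
    define s where "s = t0 + real (i - 1)"
    have s: "t0 \<le> s" "s + 1 \<le> t"
      using i t by (auto simp: s_def of_nat_diff)
    have "\<beta> / \<alpha> i - \<phi> t $ e i \<le> exp (- \<alpha> i * (t - s)) * (\<beta> / \<alpha> i - \<phi> s $ e i)"
    proof (rule exp_growth_bound)
      fix r assume r: "s \<le> r"
      show "((\<lambda>r. \<beta> / \<alpha> i - \<phi> r $ e i) has_real_derivative - f (\<phi> r) $ e i) (at r within {s..})"
        by (auto intro!: derivative_eq_intros solution_nth_deriv[OF sol s(1) r])
      show "- f (\<phi> r) $ e i \<le> - \<alpha> i * (\<beta> / \<alpha> i - \<phi> r $ e i)"
        using input[OF sol, of r] r \<alpha>_pos[OF i] by (simp add: s_def algebra_simps)
    qed (use s in auto)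
    also have "\<dots> \<le> exp (- \<alpha> i * (t - s)) * (\<beta> / \<alpha> i)"
      using solution_nonneg[OF sol s(1)] by (intro mult_left_mono) auto
    also have "\<dots> \<le> exp (- \<alpha> i) * (\<beta> / \<alpha> i)"
      using s \<alpha>_pos[OF i] \<open>0 < \<beta>\<close> by (intro mult_right_mono) auto
    finally show "\<beta> / \<alpha> i * (1 - exp (- \<alpha> i)) \<le> \<phi> t $ e i"
      by (simp add: algebra_simps)
  qed
  show ?thesis
    using assms
  proof (induction i rule: nat_induct_at_least)
    case base
    show ?case
    proof (rule step[of 1 "1 / k"])
      fix t0 a \<phi> t assume "is_solution f orthant t0 a \<phi>" "t0 + real (1 - 1) \<le> t"
      then have "0 \<le> \<phi> t $ e n"
        using solution_nonneg by simp
      then show "1 / k - \<alpha> 1 * \<phi> t $ e 1 \<le> f (\<phi> t) $ e 1"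
        using g_diff_bounds(1)[OF k_gt_1, of 0 0 "\<phi> t $ e n"] by (simp add: f_first g_def)
    qed (use n_ge_2 k_gt_1 in auto)
  next
    case (Suc i)
    then obtain \<eta> where "0 < \<eta>"
      and \<eta>: "\<And>t0 a \<phi> t. is_solution f orthant t0 a \<phi> \<Longrightarrow> t0 + real i \<le> t \<Longrightarrow> \<eta> \<le> \<phi> t $ e i"
      by auto
    show ?case
    proof (rule step[OF _ \<open>0 < \<eta>\<close>])
      fix t0 a \<phi> t assume "is_solution f orthant t0 a \<phi>" "t0 + real (Suc i - 1) \<le> t"
      then show "\<eta> - \<alpha> (Suc i) * \<phi> t $ e (Suc i) \<le> f (\<phi> t) $ e (Suc i)"
        using \<eta>[of t0 a \<phi> t] Suc f_later[of "Suc i"] by auto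
    qed (use Suc in auto)
  qed
qed

text \<open>The norm for \<open>c = 0\<close> does not increase during the waiting time \<open>n\<close>, and afterwards the norm for a
  small \<open>c > 0\<close> decays at rate \<open>c\<close>. Since the first norm dominates the second, and is dominated by it
  up to a factor close to \<open>1\<close>, the overshoot is as small as desired.\<close>

lemma SO_if_critical:
  assumes crit: "(k - 1) / k\<^sup>2 = (\<Prod>i=1..n. \<alpha> i)"
  shows "\<exists>N. is_norm N \<and> SO_on flow orthant N"
proof -
  have adm0: "admissible 0"
    using \<alpha>_pos by (simp add: admissible_def)
  have w0: "0 < weight 0 i" if "i \<in> {1..n}" for i
    using weight_pos[OF adm0 that] .
  obtain \<eta> where "0 < \<eta>" and \<eta>: "\<And>t0 a \<phi> t. is_solution f orthant t0 a \<phi> \<Longrightarrow> t0 + real n \<le> t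
      \<Longrightarrow> \<eta> \<le> \<phi> t $ e n"
    using coordinate_lower_bound[of n] n_ge_2 by auto
  have gap: "(k - 1) / (k + \<eta>)\<^sup>2 < (\<Prod>i=1..n. \<alpha> i)"
    unfolding crit[symmetric] using k_gt_1 \<open>0 < \<eta>\<close>
    by (intro divide_strict_left_mono power_strict_mono) auto
  have "\<exists>l>0. \<forall>t1\<ge>0. \<forall>t2\<ge>t1. \<forall>a\<in>orthant. \<forall>b\<in>orthant.
      wnorm 0 (flow t2 t1 a - flow t2 t1 b)
        \<le> (1 + \<epsilon>) * exp (- (t2 - t1) * l) * wnorm 0 (a - b)" if "0 < \<epsilon>" for \<epsilon>
  proof -
    have "\<forall>\<^sub>F c in at_right 0. \<forall>i\<in>{1..n}. weight 0 i * exp (real n * c) < (1 + \<epsilon>) * weight c i"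
    proof (rule eventually_ball_finite, simp, intro ballI)
      fix i assume i: "i \<in> {1..n}"
      have "((\<lambda>c. (1 + \<epsilon>) * weight c i - weight 0 i * exp (real n * c))
          \<longlongrightarrow> (1 + \<epsilon>) * weight 0 i - weight 0 i * exp (real n * 0)) (at_right 0)"
        unfolding weight_def by (intro tendsto_intros)
      moreover have "0 < (1 + \<epsilon>) * weight 0 i - weight 0 i * exp (real n * 0)"
        using w0[OF i] \<open>0 < \<epsilon>\<close> by (simp add: algebra_simps)
      ultimately have "\<forall>\<^sub>F c in at_right 0. 0 < (1 + \<epsilon>) * weight c i - weight 0 i * exp (real n * c)"
        by (rule order_tendstoD)
      then show "\<forall>\<^sub>F c in at_right 0. weight 0 i * exp (real n * c) < (1 + \<epsilon>) * weight c i"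
        by simp
    qed
    then have "\<forall>\<^sub>F c in at_right 0. 0 < c \<and> admissible c \<and> (k - 1) / (k + \<eta>)\<^sup>2 < (\<Prod>i=1..n. \<alpha> i - c)
        \<and> (\<forall>i\<in>{1..n}. weight 0 i * exp (real n * c) < (1 + \<epsilon>) * weight c i)"
      by (intro eventually_conj eventually_at_right_less eventually_admissible
          eventually_less_prod gap)
    \<comment> \<open>The factor \<open>exp (n c)\<close> pays in advance for the waiting time.\<close>
    then obtain c where c: "0 < c" "admissible c" "(k - 1) / (k + \<eta>)\<^sup>2 < (\<Prod>i=1..n. \<alpha> i - c)"
      and wc: "\<And>i. i \<in> {1..n} \<Longrightarrow> weight 0 i * exp (real n * c) < (1 + \<epsilon>) * weight c i"
      using eventually_happens trivial_limit_at_right_real by blast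
    have le_c: "wnorm 0 v \<le> (1 + \<epsilon>) * exp (- real n * c) * wnorm c v" for v
    proof (rule wnorm_mono)
      fix i assume "i \<in> {1..n}"
      from wc[OF this] show "weight 0 i \<le> (1 + \<epsilon>) * exp (- real n * c) * weight c i"
        by (simp add: exp_minus field_simps)
    qed
    have c_le: "wnorm c v \<le> 1 * wnorm 0 v" for v
    proof (rule wnorm_mono)
      fix i assume "i \<in> {1..n}"
      then have "c < \<alpha> j" if "j \<in> {1..<i}" for j
        using c(2) that by (simp add: admissible_def)
      then show "weight c i \<le> 1 * weight 0 i"
        unfolding weight_def mult_1 using c(1) by (intro prod_mono) (simp add: less_imp_le)
    qed
    have nonneg: "0 \<le> wnorm 0 v" for v
      using is_norm_wnorm[OF adm0] by (simp add: is_norm_def)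
    have "wnorm 0 (flow t2 t1 a - flow t2 t1 b)
        \<le> (1 + \<epsilon>) * exp (- (t2 - t1) * c) * wnorm 0 (a - b)"
      if "t1 \<le> t2" "a \<in> orthant" "b \<in> orthant" for t1 t2 a b
    proof (rule wnorm_bound_from_ordered[OF adm0 _ that(2,3)])
      fix a b :: "real ^ 'n" assume ab: "0 \<le> a" "a \<le> b"
      obtain \<phi> \<psi> where sol: "is_solution f orthant t1 a \<phi>" "is_solution f orthant t1 b \<psi>"
        and ord: "\<And>t. t1 \<le> t \<Longrightarrow> \<phi> t \<le> \<psi> t"
        using ordered_solutions_exist[OF ab] by metis
      define N where "N t = wnorm 0 (\<psi> t - \<phi> t)" for t
      have N_mono: "N t \<le> N t1" if "t1 \<le> t" for t
        using ordered_solutions_contract[OF sol ord order_refl solution_nonneg[OF sol(1)], where c=0 and t=t and s=t1]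
          crit that by (simp add: N_def)
      have "N t2 \<le> (1 + \<epsilon>) * exp (- (t2 - t1) * c) * N t1"
      proof (cases "t2 \<le> t1 + real n")
        case True
        \<comment> \<open>Before the waiting time has passed, the overshoot factor outweighs the exponential, so it
          suffices that the norm does not increase.\<close>
        have "- real n * c \<le> - (t2 - t1) * c"
          using True \<open>0 < c\<close> by (intro mult_right_mono) auto
        have "1 \<le> (1 + \<epsilon>) * exp (- real n * c)"
          using wc[of 1] n_ge_2 by (simp add: weight_def exp_minus field_simps)
        also have "(1 + \<epsilon>) * exp (- real n * c) \<le> (1 + \<epsilon>) * exp (- (t2 - t1) * c)"
          using \<open>0 < \<epsilon>\<close> \<open>- real n * c \<le> - (t2 - t1) * c\<close> by (intro mult_left_mono) auto
        finally have "1 * N t1 \<le> (1 + \<epsilon>) * exp (- (t2 - t1) * c) * N t1"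
          by (intro mult_right_mono) (auto simp: N_def nonneg)
        then show ?thesis
          using N_mono[OF \<open>t1 \<le> t2\<close>] by simp
      next
        case False
        define s where "s = t1 + real n"
        have "wnorm c (\<psi> t2 - \<phi> t2) \<le> exp (- (t2 - s) * c) * wnorm c (\<psi> s - \<phi> s)"
          using False c \<open>0 < \<eta>\<close> \<eta>[OF sol(1)]
          by (intro ordered_solutions_contract[OF sol ord, of \<eta>]) (auto simp: s_def)
        also have "\<dots> \<le> exp (- (t2 - s) * c) * N t1"
          using c_le[of "\<psi> s - \<phi> s"] N_mono[of s] by (intro mult_left_mono) (auto simp: N_def s_def)
        finally have "(1 + \<epsilon>) * exp (- real n * c) * wnorm c (\<psi> t2 - \<phi> t2)
            \<le> (1 + \<epsilon>) * exp (- real n * c) * (exp (- (t2 - s) * c) * N t1)"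
          using \<open>0 < \<epsilon>\<close> by (intro mult_left_mono) auto
        also have "\<dots> = (1 + \<epsilon>) * (exp (- real n * c) * exp (- (t2 - s) * c)) * N t1"
          by (simp only: mult.assoc)
        also have "exp (- real n * c) * exp (- (t2 - s) * c) = exp (- (t2 - t1) * c)"
          by (simp add: s_def exp_add[symmetric] algebra_simps)
        finally show ?thesis
          using le_c[of "\<psi> t2 - \<phi> t2"] by (simp add: N_def)
      qed
      then show "wnorm 0 (flow t2 t1 b - flow t2 t1 a)
          \<le> (1 + \<epsilon>) * exp (- (t2 - t1) * c) * wnorm 0 (b - a)"
        using solution_init[OF sol(1)] solution_init[OF sol(2)] flow_eq[OF sol(1) \<open>t1 \<le> t2\<close>]
          flow_eq[OF sol(2) \<open>t1 \<le> t2\<close>] by (simp add: N_def)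
    qed
    then show ?thesis
      using c(1) by blast
  qed
  then have "SO_on flow orthant (wnorm 0)"
    by (simp add: SO_on_def)
  then show ?thesis
    using is_norm_wnorm[OF adm0] by blast
qed

section \<open>Failure of contraction in the critical case\<close>

text \<open>Along the kernel vector \<open>v\<close> of the Jacobian at \<open>0\<close> the field changes only to second order, against
  the linear lower bound that contraction would impose.\<close>

lemma not_contractive_if_critical:
  assumes crit: "(k - 1) / k\<^sup>2 = (\<Prod>i=1..n. \<alpha> i)" and N: "is_norm N"
  shows "\<not> contractive_on flow orthant N"
proof
  assume "contractive_on flow orthant N"
  then obtain c where "0 < c"
    and contr: "\<And>t a b. 0 \<le> t \<Longrightarrow> a \<in> orthant \<Longrightarrow> b \<in> orthant \<Longrightarrow>
      N (flow t 0 a - flow t 0 b) \<le> exp (- t * c) * N (a - b)"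
    unfolding contractive_on_def by (metis diff_zero order_refl)
  have scale: "N (r *\<^sub>R v) = \<bar>r\<bar> * N v" and nonneg: "0 \<le> N v" and pos: "v \<noteq> 0 \<Longrightarrow> 0 < N v" for r v
    using N by (auto simp: is_norm_def order_less_le)
  \<comment> \<open>The kernel vector: \<open>v\<^sub>n = 1\<close> and \<open>v\<^sub>i\<^sub>-\<^sub>1 = \<alpha>\<^sub>i v\<^sub>i\<close>; criticality closes the cycle.\<close>
  define v :: "real ^ 'n" where
    "v = (\<chi> j. \<Prod>i=Suc (inv_into {1..n} e j)..n. \<alpha> i)"
  have v_nth: "v $ e i = (\<Prod>i=Suc i..n. \<alpha> i)" if "i \<in> {1..n}" for i
    using bij_betw_inv_into_left[OF bij that] by (simp add: v_def)
  have v_n: "v $ e n = 1"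
    using v_nth[of n] n_ge_2 by simp
  have v_rec: "v $ e (i - 1) = \<alpha> i * v $ e i" if "i \<in> {2..n}" for i
  proof -
    have "i - 1 \<in> {1..n}" "i \<in> {1..n}" "Suc (i - 1) = i"
      using that by auto
    with v_nth[of i] v_nth[of "i - 1"] show ?thesis
      by (simp add: prod.atLeast_Suc_atMost)
  qed
  have v_first: "\<alpha> 1 * v $ e 1 = (k - 1) / k\<^sup>2"
    using v_nth[of 1] n_ge_2 by (simp add: crit prod.atLeast_Suc_atMost)
  have v_nonneg: "0 \<le> v"
    unfolding less_eq_vec_def v_def
    by (auto intro!: prod_nonneg order.strict_implies_order[OF \<alpha>_pos] simp del: One_nat_def)
  have "v \<noteq> 0"
    using v_n by auto
  define u :: "real ^ 'n" where "u = axis (e 1) 1"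
  have "u \<noteq> 0"
    by (simp add: u_def axis_eq_0_iff)
  define G where "G = (k - 1) / k ^ 3"
  have "0 < G"
    using k_gt_1 by (simp add: G_def)
  have bound: "c * N v \<le> \<delta> * (G * N u)" if "0 < \<delta>" for \<delta>
  proof -
    have field: "f (\<delta> *\<^sub>R v) - f 0 = (- (\<delta>\<^sup>2 * ((k - 1) / (k\<^sup>2 * (k + \<delta>))))) *\<^sub>R u"
      unfolding vec_eq_iff
    proof
      fix j
      have "g k \<delta> - g k 0 - \<delta> * ((k - 1) / k\<^sup>2) = - (\<delta>\<^sup>2 * ((k - 1) / (k\<^sup>2 * (k + \<delta>))))"
      proof -
        define D where "D = k + \<delta>"
        have "0 < D" "\<delta> = D - k"
          using k_gt_1 that by (simp_all add: D_def)
        have "g k \<delta> - g k 0 = (k - 1) * \<delta> / (k * D)"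
          using k_gt_1 that by (simp add: g_diff D_def)
        also have "\<dots> = \<delta> * (k - 1) * k / (k\<^sup>2 * D)"
          using k_gt_1 by (simp add: power2_eq_square)
        finally have "g k \<delta> - g k 0 = \<delta> * (k - 1) * k / (k\<^sup>2 * D)" .
        moreover have "\<delta> * ((k - 1) / k\<^sup>2) = \<delta> * (k - 1) * D / (k\<^sup>2 * D)"
          using \<open>0 < D\<close> by simp
        ultimately have "g k \<delta> - g k 0 - \<delta> * ((k - 1) / k\<^sup>2)
            = (\<delta> * (k - 1) * k - \<delta> * (k - 1) * D) / (k\<^sup>2 * D)"
          by (simp only: diff_divide_distrib)
        also have "\<delta> * (k - 1) * k - \<delta> * (k - 1) * D = - (\<delta>\<^sup>2 * (k - 1))"
          by (simp add: D_def power2_eq_square algebra_simps)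
        finally show ?thesis
          by (simp add: D_def)
      qed
      moreover have "(f (\<delta> *\<^sub>R v) - f 0) $ e 1 = g k \<delta> - g k 0 - \<delta> * (\<alpha> 1 * v $ e 1)"
        by (simp add: f_first v_n)
      ultimately have "(f (\<delta> *\<^sub>R v) - f 0) $ e 1 = - (\<delta>\<^sup>2 * ((k - 1) / (k\<^sup>2 * (k + \<delta>))))"
        unfolding v_first by simp
      moreover have "(f (\<delta> *\<^sub>R v) - f 0) $ e i = 0" "u $ e i = 0" if "i \<in> {2..n}" for i
        using that v_rec[of i] e_inj[of 1 i] by (auto simp: f_later u_def axis_def)
      ultimately show "(f (\<delta> *\<^sub>R v) - f 0) $ j
          = ((- (\<delta>\<^sup>2 * ((k - 1) / (k\<^sup>2 * (k + \<delta>))))) *\<^sub>R u) $ j"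
        by (cases j rule: index_cases) (simp_all add: u_def)
    qed
    have "0 \<le> \<delta> *\<^sub>R v"
      using v_nonneg that by (simp add: less_eq_vec_def)
    obtain \<phi> \<psi> where sol: "is_solution f orthant 0 0 \<psi>" "is_solution f orthant 0 (\<delta> *\<^sub>R v) \<phi>"
      using ordered_solutions_exist[OF order_refl \<open>0 \<le> \<delta> *\<^sub>R v\<close>] by metis
    have "c * N (\<delta> *\<^sub>R v - 0) \<le> N (f (\<delta> *\<^sub>R v) - f 0)"
    proof (rule contraction_rate_le_field[OF N sol(2,1)])
      fix t :: real assume "0 \<le> t"
      then show "N (\<phi> t - \<psi> t) \<le> exp (- t * c) * N (\<delta> *\<^sub>R v - 0)"
        using contr[of t "\<delta> *\<^sub>R v" 0] flow_eq[OF sol(1)] flow_eq[OF sol(2)] \<open>0 \<le> \<delta> *\<^sub>R v\<close>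
        by (simp add: mem_nonneg_orthant)
    qed
    also have "\<dots> = \<delta>\<^sup>2 * ((k - 1) / (k\<^sup>2 * (k + \<delta>))) * N u"
      unfolding field scale using that k_gt_1 by (simp add: abs_mult)
    also have "\<dots> \<le> \<delta>\<^sup>2 * G * N u"
    proof (intro mult_right_mono mult_left_mono nonneg)
      have "k\<^sup>2 * k \<le> k\<^sup>2 * (k + \<delta>)"
        using that by (intro mult_left_mono) auto
      then show "(k - 1) / (k\<^sup>2 * (k + \<delta>)) \<le> G"
        unfolding G_def using k_gt_1 by (intro frac_le) (auto simp: power3_eq_cube power2_eq_square)
    qed simp
    finally have "\<delta> * (c * N v) \<le> \<delta> * (\<delta> * (G * N u))"
      using that by (simp add: scale power2_eq_square mult_ac)
    then show ?thesis
      using that by simp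
  qed
  have "0 < N u" "0 < c * N v"
    using pos \<open>u \<noteq> 0\<close> \<open>v \<noteq> 0\<close> \<open>0 < c\<close> by auto
  moreover have "c * N v \<le> c * N v / 2"
    using bound[of "c * N v / (2 * (G * N u))"] \<open>0 < N u\<close> \<open>0 < c * N v\<close> \<open>0 < G\<close> by simp
  ultimately show False
    by simp
qed

end

section \<open>Contraction properties of the cyclic system\<close>

theorem proposition1:
  fixes e :: "nat \<Rightarrow> 'n::finite" and \<alpha> :: "nat \<Rightarrow> real" and k :: real
    and x :: "real \<Rightarrow> real \<Rightarrow> real ^ 'n \<Rightarrow> real ^ 'n"
  assumes "2 \<le> CARD('n)"
    and "bij_betw e {1..CARD('n)} UNIV"
    and "\<And>i. i \<in> {1..CARD('n)} \<Longrightarrow> 0 < \<alpha> i"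
    and "1 < k"
  defines "x \<equiv> solution_at (vector_field e \<alpha> k) nonneg_orthant"
  shows "(k - 1 < (\<Prod>i=1..CARD('n). \<alpha> i) * k\<^sup>2 \<longrightarrow>
            (\<exists>N. is_norm N \<and> contractive_on x nonneg_orthant N)) \<and>
         (k - 1 = (\<Prod>i=1..CARD('n). \<alpha> i) * k\<^sup>2 \<longrightarrow>
            (\<forall>N. is_norm N \<longrightarrow> \<not> contractive_on x nonneg_orthant N) \<and>
            (\<exists>N. is_norm N \<and> SO_on x nonneg_orthant N))"
proof -
  interpret cyclic_system e \<alpha> k "CARD('n)"
    using assms(1-4) by unfold_locales simp_all
  have "0 < k\<^sup>2"
    using \<open>1 < k\<close> by simp
  then have "k - 1 < (\<Prod>i=1..CARD('n). \<alpha> i) * k\<^sup>2 \<longleftrightarrow> (k - 1) / k\<^sup>2 < (\<Prod>i=1..CARD('n). \<alpha> i)"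
    and "k - 1 = (\<Prod>i=1..CARD('n). \<alpha> i) * k\<^sup>2 \<longleftrightarrow> (k - 1) / k\<^sup>2 = (\<Prod>i=1..CARD('n). \<alpha> i)"
    by (simp_all only: pos_divide_less_eq divide_eq_eq) auto
  then show ?thesis
    unfolding x_def
    using contractive_if_subcritical not_contractive_if_critical SO_if_critical by blast
qed

end
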